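(* Let $\mathrm{d}+A$ be an $\mathfrak{sl}_2$-connection on the formal punctured disc with associated symmetric matrices $C_k$. For all $n,k\in\mathbb{Z}$, $$\left[L_n^{\mathrm{d}+A},\begin{pmatrix}\psi_k^+\\\psi_k^-\end{pmatrix}\right]=(-k)\begin{pmatrix}\psi_{n+k}^+\\\psi_{n+k}^-\end{pmatrix}+\sum_{i\in\mathbb{Z}}\begin{pmatrix}-C^{-+}_{n-i+k}&C^{++}_{n-i+k}\\-C^{--}_{n-i+k}&C^{+-}_{n-i+k}\end{pmatrix}\begin{pmatrix}\psi_i^+\\\psi_i^-\end{pmatrix}.$$
   Context: All algebras are over $\mathbb{C}$. Indices $a,b\in\{+,-\}$; $\mathbb{C}^2$ has basis $e^+,e^-$ and symplectic form $(e^+,e^-)=1=-(e^-,e^+)$, $(e^\pm,e^\pm)=0$. The connection is $\mathrm{d}+A$ with $A(z)=\sum_{k\in\mathbb{Z}}A_kz^{-k-1}$, $A_k\in\mathfrak{sl}_2(\mathbb{C})$, with a pole of finite order, i.e. $A_k=0$ for all sufficiently large $k$. Put $C_k=\begin{pmatrix}0&-1\\1&0\end{pmatrix}A_k$ (rows and columns indexed by $+,-$ in this order), a symmetric matrix with entries $C_k^{ab}$. $\mathcal{SF}_{\mathrm{d}+A}$ is the unital associative (Clifford) algebra with generators $\psi^\pm_n$, $n\in\mathbb{Z}$, and relations $\{\psi^a_m,\psi^b_n\}=m\,(e^a,e^b)\,\delta_{m+n,0}+C_{m+n}^{ab}$, where $\{x,y\}=xy+yx$. Normal ordering: $:\psi_i^a\psi_j^b:\;=\psi_i^a\psi_j^b$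 if $i<j$, $-\psi_j^b\psi_i^a$ if $i>j$, and $\frac12(\psi_i^a\psi_j^b-\psi_j^b\psi_i^a)$ if $i=j$. Set $$L_n^{\mathrm{d}+A}=\sum_{i+j=n}:\psi_i^-\psi_j^+:\;+\;c_n1,\qquad c_n=\tfrac12\sum_{i+j=n}\big(C_i^{-+}C_j^{+-}-C_i^{++}C_j^{--}\big).$$ Infinite sums are understood as operators on $\mathcal{SF}_{\mathrm{d}+A}$-modules in which every vector is annihilated by $\psi_n^\pm$ for all sufficiently large $n$. The commutator with a column vector is taken entrywise. *)

theory Defs
  imports
    "HOL-Analysis.Determinants"
    "HOL-Library.Poly_Mapping"
    "HOL-Algebra.QuotRing"
    "HOL-Algebra.Algebraic_Closure_Type"
begin

section \<open>Connections with values in traceless two by two matrices\<close>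

datatype pm = Plus | Minus

lemma UNIV_pm: "(UNIV :: pm set) = {Plus, Minus}"
  using pm.exhaust by auto

instance pm :: finite
  by standard (simp add: UNIV_pm)

lemma sum_pm: "(\<Sum>b\<in>UNIV. f b) = f Plus + f Minus"
  by (simp add: UNIV_pm)

text \<open>The matrix with rows \<open>(p, q)\<close> and \<open>(r, s)\<close>, where \<^const>\<open>Plus\<close> comes before \<^const>\<open>Minus\<close>.\<close>

definition pm_matrix :: "complex \<Rightarrow> complex \<Rightarrow> complex \<Rightarrow> complex \<Rightarrow> complex^pm^pm" where
  "pm_matrix p q r s = (\<chi> a b. case a of
      Plus \<Rightarrow> (case b of Plus \<Rightarrow> p | Minus \<Rightarrow> q)
    | Minus \<Rightarrow> (case b of Plus \<Rightarrow> r | Minus \<Rightarrow> s))"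

lemma pm_matrix_nth [simp]:
  "pm_matrix p q r s $ Plus $ Plus = p" "pm_matrix p q r s $ Plus $ Minus = q"
  "pm_matrix p q r s $ Minus $ Plus = r" "pm_matrix p q r s $ Minus $ Minus = s"
  by (simp_all add: pm_matrix_def)

text \<open>The family \<open>A\<close> stands for the connection form \<open>A(z) = \<Sum>k. A k z\<^sup>-\<^sup>k\<^sup>-\<^sup>1\<close>; a pole
  of finite order therefore means vanishing of \<open>A k\<close> for large positive \<open>k\<close>.\<close>

definition sl2_connection :: "(int \<Rightarrow> complex^pm^pm) \<Rightarrow> bool" where
  "sl2_connection A \<longleftrightarrow> (\<forall>k. trace (A k) = 0) \<and> (\<exists>N. \<forall>k\<ge>N. A k = 0)"

definition Cmat :: "(int \<Rightarrow> complex^pm^pm) \<Rightarrow> int \<Rightarrow> complex^pm^pm" where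
  "Cmat A k = pm_matrix 0 (-1) 1 0 ** A k"

lemma Cmat_nth:
  "Cmat A k $ Plus $ b = - (A k $ Minus $ b)" "Cmat A k $ Minus $ b = A k $ Plus $ b"
  by (simp_all add: Cmat_def matrix_matrix_mult_def sum_pm)

lemma Cmat_symmetric:
  assumes "sl2_connection A"
  shows "transpose (Cmat A k) = Cmat A k"
proof -
  have "A k $ Plus $ Plus + A k $ Minus $ Minus = 0"
    using assms by (simp add: sl2_connection_def trace_def sum_pm)
  then have "Cmat A k $ Minus $ Plus = Cmat A k $ Plus $ Minus"
    by (simp add: Cmat_nth add_eq_0_iff2)
  then have "Cmat A k $ b $ a = Cmat A k $ a $ b" for a b
    by (cases a; cases b) simp_all
  then show ?thesis by (simp add: transpose_def vec_eq_iff)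
qed

lemma Cmat_eventually_zero:
  assumes "sl2_connection A"
  obtains N where "\<And>k. k \<ge> N \<Longrightarrow> Cmat A k = 0"
proof -
  obtain N where "\<And>k. k \<ge> N \<Longrightarrow> A k = 0"
    using assms unfolding sl2_connection_def by blast
  then have "Cmat A k = 0" if "k \<ge> N" for k
    using that by (simp add: Cmat_def matrix_matrix_mult_def vec_eq_iff)
  then show thesis by (rule that)
qed

text \<open>The symplectic form on \<open>\<complex>\<^sup>2\<close>, evaluated on the basis vectors.\<close>

fun sympl :: "pm \<Rightarrow> pm \<Rightarrow> complex" where
  "sympl Plus Minus = 1"
| "sympl Minus Plus = -1"
| "sympl Plus Plus = 0"
| "sympl Minus Minus = 0"


section \<open>The Clifford algebra by generators and relations\<close>

text \<open>Lists form a monoid under concatenation; finitely supported functions on lists are then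
  the free associative algebra, with convolution as product.\<close>

instantiation list :: (type) monoid_add
begin

definition zero_list :: "'a list" where "zero_list = []"

definition plus_list :: "'a list \<Rightarrow> 'a list \<Rightarrow> 'a list" where "plus_list = append"

instance by standard (simp_all add: zero_list_def plus_list_def)

end

type_synonym free_alg = "(pm \<times> int) list \<Rightarrow>\<^sub>0 complex"

definition free_gen :: "pm \<Rightarrow> int \<Rightarrow> free_alg" where
  "free_gen a n = Poly_Mapping.single [(a, n)] 1"

definition free_scalar :: "complex \<Rightarrow> free_alg" where
  "free_scalar c = Poly_Mapping.single [] c"

definition SF_relators :: "(int \<Rightarrow> complex^pm^pm) \<Rightarrow> free_alg set" where
  "SF_relators A = {free_gen a m * free_gen b n + free_gen b n * free_gen a m
      - free_scalar (of_int m * sympl a b * of_bool (m + n = 0) + Cmat A (m + n) $ a $ b)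
      | a b m n. True}"

definition SF_ideal :: "(int \<Rightarrow> complex^pm^pm) \<Rightarrow> free_alg set" where
  "SF_ideal A = Idl\<^bsub>ring_of_type_algebra\<^esub> (SF_relators A)"

definition SF :: "(int \<Rightarrow> complex^pm^pm) \<Rightarrow> free_alg set ring" where
  "SF A = ring_of_type_algebra Quot SF_ideal A"

definition SF_class :: "(int \<Rightarrow> complex^pm^pm) \<Rightarrow> free_alg \<Rightarrow> free_alg set" where
  "SF_class A x = SF_ideal A +>\<^bsub>ring_of_type_algebra\<^esub> x"

definition psi :: "(int \<Rightarrow> complex^pm^pm) \<Rightarrow> pm \<Rightarrow> int \<Rightarrow> free_alg set" where
  "psi A a n = SF_class A (free_gen a n)"

definition SF_scalar :: "(int \<Rightarrow> complex^pm^pm) \<Rightarrow> complex \<Rightarrow> free_alg set" where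
  "SF_scalar A c = SF_class A (free_scalar c)"

text \<open>The normally ordered product of \<open>psi A a i\<close> and \<open>psi A b j\<close>.\<close>

definition normal_ord ::
    "(int \<Rightarrow> complex^pm^pm) \<Rightarrow> pm \<Rightarrow> int \<Rightarrow> pm \<Rightarrow> int \<Rightarrow> free_alg set" where
  "normal_ord A a i b j =
    (if i < j then psi A a i \<otimes>\<^bsub>SF A\<^esub> psi A b j
     else if i > j then \<ominus>\<^bsub>SF A\<^esub> (psi A b j \<otimes>\<^bsub>SF A\<^esub> psi A a i)
     else SF_scalar A (1/2) \<otimes>\<^bsub>SF A\<^esub>
       (psi A a i \<otimes>\<^bsub>SF A\<^esub> psi A b j \<ominus>\<^bsub>SF A\<^esub> psi A b j \<otimes>\<^bsub>SF A\<^esub> psi A a i))"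


section \<open>Modules and the operators L\<close>

definition End_ring :: "(complex \<Rightarrow> 'v \<Rightarrow> 'v::ab_group_add) \<Rightarrow> ('v \<Rightarrow> 'v) ring" where
  "End_ring smul = \<lparr>carrier = {f. Vector_Spaces.linear smul smul f},
     mult = (\<circ>), one = id, zero = (\<lambda>v. 0), add = (\<lambda>f g v. f v + g v)\<rparr>"

text \<open>A module over \<open>SF A\<close> on which every vector is killed by all generators of large index.
  The condition on scalars makes \<open>\<rho>\<close> a homomorphism of algebras and not just of rings.\<close>

definition smooth_SF_module ::
    "(int \<Rightarrow> complex^pm^pm) \<Rightarrow> (complex \<Rightarrow> 'v \<Rightarrow> 'v::ab_group_add) \<Rightarrow>
     (free_alg set \<Rightarrow> 'v \<Rightarrow> 'v) \<Rightarrow> bool" where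
  "smooth_SF_module A smul \<rho> \<longleftrightarrow>
     vector_space smul \<and>
     \<rho> \<in> ring_hom (SF A) (End_ring smul) \<and>
     (\<forall>c. \<rho> (SF_scalar A c) = smul c) \<and>
     (\<forall>v. \<exists>N. \<forall>n\<ge>N. \<forall>a. \<rho> (psi A a n) v = 0)"

text \<open>Sums over all integers are rendered by \<^const>\<open>Sum_any\<close>, which adds up the nonzero terms and
  is only meaningful if there are finitely many of them; the lemmas at the end of this theory show
  that this is so for all the sums below. A sum over \<open>i + j = n\<close> is indexed by \<open>i\<close>.\<close>

definition c_const :: "(int \<Rightarrow> complex^pm^pm) \<Rightarrow> int \<Rightarrow> complex" where
  "c_const A n = 1/2 * Sum_any (\<lambda>i. Cmat A i $ Minus $ Plus * Cmat A (n - i) $ Plus $ Minus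
                                   - Cmat A i $ Plus $ Plus * Cmat A (n - i) $ Minus $ Minus)"

definition L_op ::
    "(int \<Rightarrow> complex^pm^pm) \<Rightarrow> (complex \<Rightarrow> 'v \<Rightarrow> 'v::ab_group_add) \<Rightarrow>
     (free_alg set \<Rightarrow> 'v \<Rightarrow> 'v) \<Rightarrow> int \<Rightarrow> 'v \<Rightarrow> 'v" where
  "L_op A smul \<rho> n v =
     Sum_any (\<lambda>i. \<rho> (normal_ord A Minus i Plus (n - i)) v) + smul (c_const A n) v"

definition op_commutator :: "('v \<Rightarrow> 'v) \<Rightarrow> ('v \<Rightarrow> 'v) \<Rightarrow> 'v \<Rightarrow> 'v::ab_group_add" where
  "op_commutator f g v = f (g v) - g (f v)"

definition comm_matrix :: "(int \<Rightarrow> complex^pm^pm) \<Rightarrow> int \<Rightarrow> complex^pm^pm" where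
  "comm_matrix A m = pm_matrix
     (- (Cmat A m $ Minus $ Plus))  (Cmat A m $ Plus $ Plus)
     (- (Cmat A m $ Minus $ Minus)) (Cmat A m $ Plus $ Minus)"


section \<open>Basic facts, and finiteness of the sums\<close>

lemma ring_ring_of_type_algebra: "ring (ring_of_type_algebra :: 'a::ring_1 ring)"
proof -
  have "\<exists>y. x + y = 0" for x :: 'a
    using add.right_inverse by blast
  then show ?thesis
    unfolding ring_of_type_algebra_def using add.right_inverse
    by unfold_locales (auto simp: algebra_simps Units_def)
qed

lemma SF_relators_subset: "SF_relators A \<subseteq> carrier ring_of_type_algebra"
  by (simp add: ring_of_type_algebra_def)

lemma SF_ideal: "ideal (SF_ideal A) ring_of_type_algebra"
  unfolding SF_ideal_def
  by (rule ring.genideal_ideal[OF ring_ring_of_type_algebra SF_relators_subset])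

lemma ring_SF: "ring (SF A)"
  unfolding SF_def by (rule ideal.quotient_is_ring[OF SF_ideal])

lemma SF_class_hom: "SF_class A \<in> ring_hom ring_of_type_algebra (SF A)"
  using ideal.rcos_ring_hom[OF SF_ideal] by (simp add: SF_class_def[abs_def] SF_def)

lemma SF_class_closed [simp]: "SF_class A x \<in> carrier (SF A)"
  using ring_hom_closed[OF SF_class_hom] by (simp add: ring_of_type_algebra_def)

lemma SF_class_mult: "SF_class A (x * y) = SF_class A x \<otimes>\<^bsub>SF A\<^esub> SF_class A y"
  using ring_hom_mult[OF SF_class_hom, of x y] by (simp add: ring_of_type_algebra_def)

lemma SF_class_add: "SF_class A (x + y) = SF_class A x \<oplus>\<^bsub>SF A\<^esub> SF_class A y"
  using ring_hom_add[OF SF_class_hom, of x y] by (simp add: ring_of_type_algebra_def)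

lemma psi_closed [simp]: "psi A a n \<in> carrier (SF A)"
  by (simp add: psi_def)

lemma SF_scalar_closed [simp]: "SF_scalar A c \<in> carrier (SF A)"
  by (simp add: SF_scalar_def)

lemma psi_anticommutator:
  "psi A a m \<otimes>\<^bsub>SF A\<^esub> psi A b n \<oplus>\<^bsub>SF A\<^esub> psi A b n \<otimes>\<^bsub>SF A\<^esub> psi A a m =
   SF_scalar A (of_int m * sympl a b * of_bool (m + n = 0) + Cmat A (m + n) $ a $ b)"
proof -
  let ?x = "free_gen a m * free_gen b n + free_gen b n * free_gen a m"
  let ?y = "free_scalar (of_int m * sympl a b * of_bool (m + n = 0) + Cmat A (m + n) $ a $ b)"
  have "?x - ?y \<in> SF_ideal A"
    using ring.genideal_self[OF ring_ring_of_type_algebra SF_relators_subset, of A]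
    unfolding SF_ideal_def SF_relators_def by blast
  then have "SF_class A (?x - ?y) = \<zero>\<^bsub>SF A\<^esub>"
    by (simp add: SF_class_def SF_def FactRing_def
        ring.a_rcos_zero[OF ring_ring_of_type_algebra SF_ideal])
  moreover have "SF_class A ?x = SF_class A (?x - ?y) \<oplus>\<^bsub>SF A\<^esub> SF_class A ?y"
    by (simp flip: SF_class_add)
  ultimately have "SF_class A ?x = SF_class A ?y"
    using ring_SF[of A] by (simp add: ring.ring_simprules)
  then show ?thesis
    by (simp add: SF_class_add SF_class_mult psi_def SF_scalar_def)
qed

context
  fixes A and smul :: "complex \<Rightarrow> 'v \<Rightarrow> 'v::ab_group_add" and \<rho>
  assumes A: "sl2_connection A" and M: "smooth_SF_module A smul \<rho>"
begin

lemma SF_action_mult: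
  assumes "x \<in> carrier (SF A)" "y \<in> carrier (SF A)"
  shows "\<rho> (x \<otimes>\<^bsub>SF A\<^esub> y) v = \<rho> x (\<rho> y v)"
  using M ring_hom_mult[of \<rho> "SF A" "End_ring smul", OF _ assms]
  by (simp add: smooth_SF_module_def End_ring_def)

lemma SF_action_add:
  assumes "x \<in> carrier (SF A)" "y \<in> carrier (SF A)"
  shows "\<rho> (x \<oplus>\<^bsub>SF A\<^esub> y) v = \<rho> x v + \<rho> y v"
  using M ring_hom_add[of \<rho> "SF A" "End_ring smul", OF _ assms]
  by (simp add: smooth_SF_module_def End_ring_def)

lemma SF_action_linear:
  assumes "x \<in> carrier (SF A)"
  shows "Vector_Spaces.linear smul smul (\<rho> x)"
  using M ring_hom_closed[of \<rho> "SF A" "End_ring smul", OF _ assms]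
  by (simp add: smooth_SF_module_def End_ring_def)

lemma SF_action_zero_right:
  assumes "x \<in> carrier (SF A)"
  shows "\<rho> x 0 = 0"
  using Vector_Spaces.linear.axioms(3)[OF SF_action_linear[OF assms]]
  by (rule module_hom.zero)

lemma SF_action_uminus:
  assumes "x \<in> carrier (SF A)"
  shows "\<rho> (\<ominus>\<^bsub>SF A\<^esub> x) v = - \<rho> x v"
proof -
  interpret ring "SF A" by (rule ring_SF)
  have "\<rho> \<zero>\<^bsub>SF A\<^esub> v + \<rho> \<zero>\<^bsub>SF A\<^esub> v = \<rho> \<zero>\<^bsub>SF A\<^esub> v"
    using SF_action_add[of "\<zero>\<^bsub>SF A\<^esub>" "\<zero>\<^bsub>SF A\<^esub>" v] by simp
  then have "\<rho> (\<ominus>\<^bsub>SF A\<^esub> x) v + \<rho> x v = 0"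
    using SF_action_add[of "\<ominus>\<^bsub>SF A\<^esub> x" x v] assms by (simp add: l_neg)
  then show ?thesis by (simp add: eq_neg_iff_add_eq_0)
qed

lemma finite_support_L:
  "finite {i. \<rho> (normal_ord A Minus i Plus (n - i)) v \<noteq> 0}"
proof -
  interpret ring "SF A" by (rule ring_SF)
  obtain N where N: "\<And>k a. k \<ge> N \<Longrightarrow> \<rho> (psi A a k) v = 0"
    using M unfolding smooth_SF_module_def by blast
  have "\<rho> (normal_ord A Minus i Plus (n - i)) v = 0" if "i > \<bar>n\<bar> + \<bar>N\<bar>" for i
    using that
    by (auto simp: normal_ord_def SF_action_uminus SF_action_mult N SF_action_zero_right)
  moreover have "\<rho> (normal_ord A Minus i Plus (n - i)) v = 0" if "i < - \<bar>n\<bar> - \<bar>N\<bar>" for i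
    using that by (auto simp: normal_ord_def SF_action_mult N SF_action_zero_right)
  ultimately have "{i. \<rho> (normal_ord A Minus i Plus (n - i)) v \<noteq> 0}
      \<subseteq> {- \<bar>n\<bar> - \<bar>N\<bar>..\<bar>n\<bar> + \<bar>N\<bar>}"
    by (force simp: not_less)
  then show ?thesis by (rule finite_subset) simp
qed

lemma finite_support_c:
  "finite {i. Cmat A i $ Minus $ Plus * Cmat A (n - i) $ Plus $ Minus
            - Cmat A i $ Plus $ Plus * Cmat A (n - i) $ Minus $ Minus \<noteq> 0}"
proof -
  obtain N where N: "\<And>k. k \<ge> N \<Longrightarrow> Cmat A k = 0"
    using Cmat_eventually_zero[OF A] by blast
  have "i < N \<and> n - i < N" if "Cmat A i $ Minus $ Plus * Cmat A (n - i) $ Plus $ Minus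
            - Cmat A i $ Plus $ Plus * Cmat A (n - i) $ Minus $ Minus \<noteq> 0" for i
    using that N[of i] N[of "n - i"] by (cases "i < N"; cases "n - i < N") auto
  then have "{i. Cmat A i $ Minus $ Plus * Cmat A (n - i) $ Plus $ Minus
            - Cmat A i $ Plus $ Plus * Cmat A (n - i) $ Minus $ Minus \<noteq> 0} \<subseteq> {n - N..N}"
    by force
  then show ?thesis by (rule finite_subset) simp
qed

lemma finite_support_comm:
  "finite {i. (\<Sum>b\<in>UNIV. smul (comm_matrix A (n - i + k) $ a $ b) (\<rho> (psi A b i) v)) \<noteq> 0}"
proof -
  interpret vector_space smul
    using M by (simp add: smooth_SF_module_def)
  obtain N where N: "\<And>k a. k \<ge> N \<Longrightarrow> \<rho> (psi A a k) v = 0"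
    using M unfolding smooth_SF_module_def by blast
  obtain N' where N': "\<And>k. k \<ge> N' \<Longrightarrow> Cmat A k = 0"
    using Cmat_eventually_zero[OF A] by blast
  have "comm_matrix A m $ a $ b = 0" if "m \<ge> N'" for m b
    using that by (cases a; cases b) (simp_all add: comm_matrix_def N')
  then have "{i. (\<Sum>b\<in>UNIV. smul (comm_matrix A (n - i + k) $ a $ b) (\<rho> (psi A b i) v)) \<noteq> 0}
      \<subseteq> {n + k - N'..N}"
    using N by (force simp: not_le[symmetric] sum_pm intro: ccontr)
  then show ?thesis by (rule finite_subset) simp
qed

end

end

theory Submission
  imports Defs
begin

text \<open>Normal ordering changes \<open>\<psi>\<^sub>i\<^sup>-\<psi>\<^sub>j\<^sup>+\<close> only by a scalar, and scalars are
  invisible to the commutator; the same goes for \<open>c\<^sub>n\<close>. Hence each summand contributes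
  \<open>[\<psi>\<^sub>i\<^sup>-\<psi>\<^sub>j\<^sup>+, \<psi>\<^sub>k] = \<psi>\<^sub>i\<^sup>-{\<psi>\<^sub>j\<^sup>+, \<psi>\<^sub>k} - {\<psi>\<^sub>i\<^sup>-, \<psi>\<^sub>k}\<psi>\<^sub>j\<^sup>+\<close>, where both anticommutators are scalars. On a
  fixed vector the two halves can be summed separately, and in the second one the roles of \<open>i\<close> and
  \<open>j = n - i\<close> are exchanged.\<close>

text \<open>The scalar that the defining relations assign to the anticommutator of
  \<open>psi A a m\<close> and \<open>psi A b n\<close>.\<close>

definition psi_bracket :: "(int \<Rightarrow> complex^pm^pm) \<Rightarrow> pm \<Rightarrow> int \<Rightarrow> pm \<Rightarrow> int \<Rightarrow> complex" where
  "psi_bracket A a m b n = of_int m * sympl a b * of_bool (m + n = 0) + Cmat A (m + n) $ a $ b"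

lemma Sum_any_reflect:
  fixes f :: "int \<Rightarrow> 'a::comm_monoid_add"
  shows "Sum_any (\<lambda>i. f (n - i)) = Sum_any f"
proof -
  have "bij (\<lambda>i. n - i)"
    by (rule bij_betw_byWitness[where f' = "\<lambda>i. n - i"]) auto
  then show ?thesis
    by (intro Sum_any.reindex_cong[symmetric, where l = "\<lambda>i. n - i"])
       (auto simp: bij_def comp_def fun_eq_iff)
qed

text \<open>\<open>Sum_any\<close> defaults to 0 on an infinite support, so all three sums are
  expanded over one finite set that contains both supports.\<close>

lemma Sum_any_minus:
  fixes f g :: "'a \<Rightarrow> 'b::ab_group_add"
  assumes "finite {i. f i \<noteq> 0}" "finite {i. g i \<noteq> 0}"
  shows "Sum_any (\<lambda>i. f i - g i) = Sum_any f - Sum_any g"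
proof -
  have S: "finite ({i. f i \<noteq> 0} \<union> {i. g i \<noteq> 0})" (is "finite ?S")
    using assms by simp
  have "Sum_any (\<lambda>i. f i - g i) = (\<Sum>i\<in>?S. f i - g i)"
    by (rule Sum_any.expand_superset[OF S]) auto
  moreover have "Sum_any f = sum f ?S" "Sum_any g = sum g ?S"
    by (rule Sum_any.expand_superset[OF S]; auto)+
  ultimately show ?thesis by (simp add: sum_subtractf)
qed

lemma SF_closed:
  assumes "x \<in> carrier (SF A)"
  shows "\<ominus>\<^bsub>SF A\<^esub> x \<in> carrier (SF A)"
    "y \<in> carrier (SF A) \<Longrightarrow> x \<otimes>\<^bsub>SF A\<^esub> y \<in> carrier (SF A)"
    "y \<in> carrier (SF A) \<Longrightarrow> x \<oplus>\<^bsub>SF A\<^esub> y \<in> carrier (SF A)"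
  using assms by (simp_all add: ring.ring_simprules[OF ring_SF])

context
  fixes A and smul :: "complex \<Rightarrow> 'v \<Rightarrow> 'v::ab_group_add" and \<rho>
  assumes A: "sl2_connection A" and M: "smooth_SF_module A smul \<rho>"
begin

interpretation vector_space smul
  using M by (simp add: smooth_SF_module_def)

lemma SF_scalar_action: "\<rho> (SF_scalar A c) v = smul c v"
  using M by (simp add: smooth_SF_module_def)

lemma SF_action_linear_map:
  assumes "x \<in> carrier (SF A)"
  shows "\<rho> x (u + w) = \<rho> x u + \<rho> x w" "\<rho> x (u - w) = \<rho> x u - \<rho> x w"
    "\<rho> x (smul c u) = smul c (\<rho> x u)" "\<rho> x (sum f S) = (\<Sum>i\<in>S. \<rho> x (f i))"
proof -
  interpret l: Vector_Spaces.linear smul smul "\<rho> x"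
    by (rule SF_action_linear[OF A M assms])
  show "\<rho> x (u + w) = \<rho> x u + \<rho> x w" by (rule l.add)
  show "\<rho> x (u - w) = \<rho> x u - \<rho> x w" by (rule l.diff)
  show "\<rho> x (smul c u) = smul c (\<rho> x u)" by (rule l.scale)
  show "\<rho> x (sum f S) = (\<Sum>i\<in>S. \<rho> x (f i))" by (rule l.sum)
qed

lemma SF_action_Sum_any:
  assumes "x \<in> carrier (SF A)" "finite {i. f i \<noteq> 0}"
  shows "\<rho> x (Sum_any f) = Sum_any (\<lambda>i. \<rho> x (f i))"
    and "finite {i. \<rho> x (f i) \<noteq> 0}"
proof -
  \<comment> \<open>A linear map sends 0 to 0, so applying it can only shrink the support.\<close>
  have sub: "{i. \<rho> x (f i) \<noteq> 0} \<subseteq> {i. f i \<noteq> 0}"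
    using SF_action_zero_right[OF A M assms(1)] by auto
  show "finite {i. \<rho> x (f i) \<noteq> 0}"
    by (rule finite_subset[OF sub assms(2)])
  show "\<rho> x (Sum_any f) = Sum_any (\<lambda>i. \<rho> x (f i))"
    using Sum_any.expand_superset[OF assms(2) sub]
    by (simp add: Sum_any.expand_set[of f] SF_action_linear_map(4)[OF assms(1)])
qed

text \<open>The Clifford relation as a rewrite rule on vectors. Unrestricted rewriting would swap
  back and forth, so its uses fix which generator moves to the right.\<close>

lemma psi_action_swap:
  "\<rho> (psi A b n) (\<rho> (psi A a m) v) =
   smul (psi_bracket A a m b n) v - \<rho> (psi A a m) (\<rho> (psi A b n) v)"
proof -
  have "\<rho> (psi A a m) (\<rho> (psi A b n) v) + \<rho> (psi A b n) (\<rho> (psi A a m) v)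
      = \<rho> (psi A a m \<otimes>\<^bsub>SF A\<^esub> psi A b n \<oplus>\<^bsub>SF A\<^esub> psi A b n \<otimes>\<^bsub>SF A\<^esub> psi A a m) v"
    by (simp add: SF_closed SF_action_add[OF A M] SF_action_mult[OF A M])
  also have "\<dots> = smul (psi_bracket A a m b n) v"
    by (simp add: psi_anticommutator SF_scalar_action psi_bracket_def)
  finally show ?thesis by (simp add: algebra_simps)
qed

text \<open>\<open>s\<close> is 0, the anticommutator or half of it, according to the order of
  \<open>i\<close> and \<open>j\<close>; what matters is that it is the same for all
  \<open>v\<close>.\<close>

lemma normal_ord_action:
  obtains s where
    "\<And>v. \<rho> (normal_ord A a i b j) v = \<rho> (psi A a i) (\<rho> (psi A b j) v) - smul s v"
proof -
  note simps = SF_closed normal_ord_def SF_action_mult[OF A M] SF_action_uminus[OF A M]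
    SF_action_add[OF A M] SF_scalar_action psi_action_swap[of b j a i]
  consider "i < j" | "i > j" | "i = j" by linarith
  then show thesis
  proof cases
    case 1
    then show ?thesis by (intro that[of 0]) (simp add: simps)
  next
    case 2
    then show ?thesis
      by (intro that[of "psi_bracket A a i b j"]) (simp add: simps)
  next
    case 3
    \<comment> \<open>The antisymmetrised product takes this shape after the swap: \<open>x\<close>
      is the product in the given order applied to a vector, \<open>y\<close> the anticommutator
      times that vector.\<close>
    have half: "smul (1/2) (x + (x - y)) = x - smul (1/2) y" for x y
    proof -
      have "smul (1/2) (x + (x - y)) = smul (1/2) x + smul (1/2) x - smul (1/2) y"
        by (simp add: scale_right_diff_distrib scale_right_distrib)
      also have "smul (1/2) x + smul (1/2) x = x"
        by (simp flip: scale_left_distrib)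
      finally show ?thesis .
    qed
    from 3 show ?thesis
      by (intro that[of "psi_bracket A a i b j / 2"])
         (simp add: simps psi_action_swap[of b j a j] a_minus_def half)
  qed
qed

text \<open>By linearity the correction \<open>s\<close> cancels. Moving \<open>psi A c k\<close> to
  the right past both factors changes the sign twice, so the triple products cancel and two scalar
  terms remain.\<close>

lemma normal_ord_commutator:
  "\<rho> (normal_ord A a i b j) (\<rho> (psi A c k) v) - \<rho> (psi A c k) (\<rho> (normal_ord A a i b j) v) =
   smul (psi_bracket A b j c k) (\<rho> (psi A a i) v) - smul (psi_bracket A a i c k) (\<rho> (psi A b j) v)"
proof -
  obtain s where
    s: "\<And>v. \<rho> (normal_ord A a i b j) v = \<rho> (psi A a i) (\<rho> (psi A b j) v) - smul s v"
    using normal_ord_action[of a i b j] by blast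
  show ?thesis
    by (simp add: s SF_action_linear_map psi_action_swap[of c k])
qed

text \<open>The finite order of the pole bounds \<open>i\<close> from below, smoothness of the
  module bounds it from above.\<close>

lemma finite_support_convolution:
  "finite {i. smul (Cmat A (n - i + k) $ d $ c) (\<rho> (psi A b i) v) \<noteq> 0}"
proof -
  obtain N where N: "\<And>k a. k \<ge> N \<Longrightarrow> \<rho> (psi A a k) v = 0"
    using M unfolding smooth_SF_module_def by blast
  obtain N' where N': "\<And>k. k \<ge> N' \<Longrightarrow> Cmat A k = 0"
    using Cmat_eventually_zero[OF A] by blast
  have "{i. smul (Cmat A (n - i + k) $ d $ c) (\<rho> (psi A b i) v) \<noteq> 0} \<subseteq> {n + k - N'..N}"
    using N N' by (force simp: not_le[symmetric] intro: ccontr)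
  then show ?thesis by (rule finite_subset) simp
qed

lemma psi_bracket_convolution:
  fixes n k :: int and v :: 'v
  defines "F \<equiv> \<lambda>d c b i. smul (psi_bracket A d (n - i) c k) (\<rho> (psi A b i) v)"
  shows "finite {i. F d c b i \<noteq> 0}"
    and "Sum_any (F d c b) = smul (of_int (- k) * sympl d c) (\<rho> (psi A b (n + k)) v)
           + Sum_any (\<lambda>i. smul (Cmat A (n - i + k) $ d $ c) (\<rho> (psi A b i) v))"
proof -
  let ?x = "smul (of_int (- k) * sympl d c) (\<rho> (psi A b (n + k)) v)"
  \<comment> \<open>The delta term survives only at \<open>i = n + k\<close>, where the prefactor
    \<open>n - i\<close> of the symplectic form equals \<open>- k\<close>.\<close>
  let ?D = "\<lambda>i. if i = n + k then ?x else 0"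
  let ?C = "\<lambda>i. smul (Cmat A (n - i + k) $ d $ c) (\<rho> (psi A b i) v)"
  have F: "F d c b = (\<lambda>i. ?D i + ?C i)"
    by (auto simp: F_def psi_bracket_def scale_left_distrib fun_eq_iff)
  have fD: "finite {i. ?D i \<noteq> 0}"
    by (rule finite_subset[of _ "{n + k}"]) auto
  note fC = finite_support_convolution[of n k d c b v]
  show "finite {i. F d c b i \<noteq> 0}"
    by (rule finite_subset[OF _ finite_UnI[OF fD fC]]) (auto simp: F)
  show "Sum_any (F d c b) = ?x + Sum_any ?C"
    unfolding F by (subst Sum_any.distrib[OF fD fC]) simp
qed

lemma L_op_commutator:
  "op_commutator (L_op A smul \<rho> n) (\<rho> (psi A c k)) v =
   Sum_any (\<lambda>i. smul (psi_bracket A Plus (n - i) c k) (\<rho> (psi A Minus i) v))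
   - Sum_any (\<lambda>i. smul (psi_bracket A Minus (n - i) c k) (\<rho> (psi A Plus i) v))"
proof -
  let ?N = "\<lambda>i. \<rho> (normal_ord A Minus i Plus (n - i))"
  let ?P = "\<rho> (psi A c k)"
  let ?X = "\<lambda>i. smul (psi_bracket A Plus (n - i) c k) (\<rho> (psi A Minus i) v)"
  let ?Y = "\<lambda>i. smul (psi_bracket A Minus (n - i) c k) (\<rho> (psi A Plus i) v)"
  have fin: "finite {i. ?N i w \<noteq> 0}" for w
    by (rule finite_support_L[OF A M])
  note P = SF_action_Sum_any[OF psi_closed fin[of v]]
  have Y: "finite {i. ?Y (n - i) \<noteq> 0}"
    using finite_vimageI[OF psi_bracket_convolution(1)[of Minus n c k Plus v], of "\<lambda>i. n - i"]
    by (simp add: vimage_def inj_def)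
  \<comment> \<open>The two \<open>c_const\<close> terms cancel because \<open>?P\<close> is
    linear.\<close>
  have "op_commutator (L_op A smul \<rho> n) ?P v = Sum_any (\<lambda>i. ?N i (?P v)) - ?P (Sum_any (\<lambda>i. ?N i v))"
    by (simp add: op_commutator_def L_op_def SF_action_linear_map)
  also have "\<dots> = Sum_any (\<lambda>i. ?N i (?P v) - ?P (?N i v))"
    by (simp only: P(1) Sum_any_minus[OF fin P(2)])
  \<comment> \<open>\<open>?Y\<close> is indexed by the generator left over, which is
    \<open>psi A Plus (n - i)\<close> in the summand for \<open>i\<close>.\<close>
  also have "\<dots> = Sum_any (\<lambda>i. ?X i - ?Y (n - i))"
    by (simp add: normal_ord_commutator)
  also have "\<dots> = Sum_any ?X - Sum_any (\<lambda>i. ?Y (n - i))"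
    by (rule Sum_any_minus[OF psi_bracket_convolution(1) Y])
  also have "Sum_any (\<lambda>i. ?Y (n - i)) = Sum_any ?Y"
    by (rule Sum_any_reflect)
  finally show ?thesis .
qed

text \<open>Row \<open>c\<close> of \<open>comm_matrix\<close> is
  \<open>(- C $ Minus $ c, C $ Plus $ c)\<close>, where \<open>C\<close> is the corresponding
  \<open>Cmat\<close>; its two columns give the two sums.\<close>

lemma Sum_any_comm_matrix:
  "Sum_any (\<lambda>i. \<Sum>b\<in>UNIV. smul (comm_matrix A (n - i + k) $ c $ b) (\<rho> (psi A b i) v)) =
   Sum_any (\<lambda>i. smul (Cmat A (n - i + k) $ Plus $ c) (\<rho> (psi A Minus i) v))
   - Sum_any (\<lambda>i. smul (Cmat A (n - i + k) $ Minus $ c) (\<rho> (psi A Plus i) v))"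
  by (cases c)
     (simp_all add: sum_pm comm_matrix_def
        Sum_any_minus[OF finite_support_convolution finite_support_convolution])

end

theorem lemma4p4:
  fixes A :: "int \<Rightarrow> complex^pm^pm"
    and smul :: "complex \<Rightarrow> 'v \<Rightarrow> 'v::ab_group_add"
    and \<rho> :: "free_alg set \<Rightarrow> 'v \<Rightarrow> 'v"
    and n k :: int
    and v :: 'v
  assumes "sl2_connection A"
    and "smooth_SF_module A smul \<rho>"
  shows "(\<chi> a. op_commutator (L_op A smul \<rho> n) (\<rho> (psi A a k)) v) =
         (\<chi> a. smul (of_int (- k)) (\<rho> (psi A a (n + k)) v)
              + Sum_any (\<lambda>i. \<Sum>b\<in>UNIV. smul (comm_matrix A (n - i + k) $ a $ b)
                                                (\<rho> (psi A b i) v)))"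
proof -
  interpret vector_space smul
    using assms(2) by (simp add: smooth_SF_module_def)
  have "op_commutator (L_op A smul \<rho> n) (\<rho> (psi A a k)) v =
      smul (of_int (- k)) (\<rho> (psi A a (n + k)) v)
      + Sum_any (\<lambda>i. \<Sum>b\<in>UNIV. smul (comm_matrix A (n - i + k) $ a $ b) (\<rho> (psi A b i) v))" for a
    unfolding L_op_commutator[OF assms] psi_bracket_convolution(2)[OF assms]
      Sum_any_comm_matrix[OF assms]
    \<comment> \<open>Of the two symplectic terms one vanishes: \<open>sympl Plus Minus = 1\<close>
      serves \<open>a = Minus\<close>, and for \<open>a = Plus\<close> the sign of
      \<open>sympl Minus Plus = -1\<close> is undone by the subtraction.\<close>
    by (cases a) simp_all
  then show ?thesis by simp
qed

end
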